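(* Let $G$ be a finite graph (loops and multiple edges allowed) with $d$ vertices, and fix a total order on $E(G)$. For any fixed vertex $v_0\in V(G)$, the number of acyclic orientations of $G$ with a unique sink at $v_0$ is the same as the number of sets $S\in B_G$ with $|S|=d-1$.
   Context: An orientation of $G$ is a digraph formed by replacing each edge by one of the two possible directed arcs; it is acyclic if it has no directed cycles (so a graph with a loop has no acyclic orientations). A sink is a vertex such that all arcs incident with it are directed towards it; "unique sink at $v_0$" means $v_0$ is a sink and there is no other sink. A circuit in $G$ is a cycle, i.e. a closed walk with distinct vertices, regarded as its set of edges (a loop is a circuit of length 1, and two parallel edges form a circuit of length 2). With respect to the fixed total order on $E(G)$, a broken circuit is a circuit with its largest edge removed. $B_G$, the broken circuit complex, is the set of all $S\subseteq E(G)$ which do not contain a broken circuit. *)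

theory Defs
  imports "Graph_Theory.Arc_Walk" "HOL-Library.FuncSet"
begin

text \<open>
  Undirected multigraphs. Edges have an identity of their own, so several edges may share the
  same set of endpoints; a loop is an edge whose set of endpoints is a singleton.
\<close>

record ('v, 'e) multigraph =
  vertices :: "'v set"
  edges :: "'e set"
  ends :: "'e \<Rightarrow> 'v set"

definition finite_multigraph :: "('v, 'e) multigraph \<Rightarrow> bool" where
  "finite_multigraph G \<longleftrightarrow> finite (vertices G) \<and> finite (edges G) \<and>
     (\<forall>e \<in> edges G. \<exists>u \<in> vertices G. \<exists>v \<in> vertices G. ends G e = {u, v})"

text \<open>
  The closed walk visits the vertices \<open>vs ! 0, \<dots>, vs ! (n - 1), vs ! 0\<close> along the edges
  \<open>es ! 0, \<dots>, es ! (n - 1)\<close>. Distinctness of \<open>es\<close> only matters for \<open>n = 2\<close>, where it excludes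
  running along a single edge back and forth.
\<close>

definition circuit :: "('v, 'e) multigraph \<Rightarrow> 'e set \<Rightarrow> bool" where
  "circuit G C \<longleftrightarrow> (\<exists>vs es. es \<noteq> [] \<and> length vs = length es \<and>
     distinct vs \<and> distinct es \<and> set vs \<subseteq> vertices G \<and> set es \<subseteq> edges G \<and>
     (\<forall>i < length es. ends G (es ! i) = {vs ! i, vs ! ((i + 1) mod length es)}) \<and>
     C = set es)"

text \<open>Here \<open>(f, e) \<in> r\<close> means that \<open>f\<close> is at most \<open>e\<close> in the order on the edges.\<close>

definition broken_circuit :: "('v, 'e) multigraph \<Rightarrow> 'e rel \<Rightarrow> 'e set \<Rightarrow> bool" where
  "broken_circuit G r B \<longleftrightarrow>
     (\<exists>C e. circuit G C \<and> e \<in> C \<and> (\<forall>f \<in> C. (f, e) \<in> r) \<and> B = C - {e})"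

definition broken_circuit_complex :: "('v, 'e) multigraph \<Rightarrow> 'e rel \<Rightarrow> 'e set set" where
  "broken_circuit_complex G r =
     {S. S \<subseteq> edges G \<and> \<not> (\<exists>B. broken_circuit G r B \<and> B \<subseteq> S)}"

text \<open>
  The extensionality conditions fix the values of \<open>tail\<close> and \<open>head\<close> outside the edge set, so
  that distinct elements of this set really are distinct orientations. A loop receives a single
  arc rather than two reverse ones; this is immaterial for acyclic orientations, as there are
  none in the presence of a loop.
\<close>

definition orientations :: "('v, 'e) multigraph \<Rightarrow> ('v, 'e) pre_digraph set" where
  "orientations G = {D. verts D = vertices G \<and> arcs D = edges G \<and>
     tail D \<in> extensional (edges G) \<and> head D \<in> extensional (edges G) \<and>
     (\<forall>e \<in> edges G. ends G e = {tail D e, head D e})}"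

definition acyclic_digraph :: "('v, 'e) pre_digraph \<Rightarrow> bool" where
  "acyclic_digraph D \<longleftrightarrow> \<not> (\<exists>p. pre_digraph.cycle D p)"

definition sink :: "('v, 'e) pre_digraph \<Rightarrow> 'v \<Rightarrow> bool" where
  "sink D v \<longleftrightarrow> v \<in> verts D \<and>
     (\<forall>a \<in> arcs D. tail D a = v \<or> head D a = v \<longrightarrow> head D a = v)"

definition unique_sink_at :: "('v, 'e) pre_digraph \<Rightarrow> 'v \<Rightarrow> bool" where
  "unique_sink_at D v \<longleftrightarrow> sink D v \<and> (\<forall>w. sink D w \<longrightarrow> w = v)"

end

theory Submission
  imports Defs
begin

text \<open>
  Both counts satisfy the same deletion--contraction recursion, and the edge that is removed may be
  the same on both sides, namely the smallest edge \<open>e = uv\<close>. If \<open>e\<close> is a loop, both counts vanish;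
  otherwise both equal their value for \<open>G - e\<close> plus their value for \<open>G / e\<close>.
  Without edges both are 1 for a single vertex and 0 for several.

  For orientations, the recursion holds for every edge that is not a loop. Fix an orientation \<open>R\<close>
  of \<open>G - e\<close>; it is extended to \<open>G\<close> in two ways, and on the other side it is regarded as an
  orientation of \<open>G - e\<close> and of \<open>G / e\<close>. The number of those among the first two that
  are acyclic with unique sink \<open>v0\<close> equals the number among the last two
  (\<open>rooted_acyclic_deletion_contraction\<close>). The reason is that \<open>R / e\<close> is acyclic iff
  both extensions of \<open>R\<close> are, and that the sinks can be compared by looking at \<open>u\<close> and \<open>v\<close> only.
  Since \<open>e\<close> is not a loop, the end \<open>u\<close> that disappears into the other can be chosen different
  from \<open>v0\<close>, so that \<open>v0\<close> remains a vertex of the contraction.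

  For sets of edges, the notion of a broken circuit is first replaced by connectivity: \<open>S\<close> contains a
  broken circuit iff some edge has its two ends joined by a path of smaller edges of \<open>S\<close>
  (\<open>broken_circuit_complex_iff\<close>). In this form there is no need to know the circuits of a
  contraction, only that joining two vertices in \<open>G / e\<close> by \<open>T\<close> is the same as joining them in \<open>G\<close> by
  \<open>T \<union> {e}\<close>. As \<open>e\<close> is the smallest edge, it belongs to the set of edges of \<open>S \<union> {e}\<close> below any other
  edge, and no edge is below \<open>e\<close>. Hence the admissible sets without \<open>e\<close> are those of \<open>G - e\<close>, and
  those with \<open>e\<close> correspond to those of \<open>G / e\<close> by removing \<open>e\<close>; at the same time one vertex is lost,
  so the condition \<open>|S| = |V| - 1\<close> is preserved.

  In the induction a graph is a vertex set \<open>V\<close>, an edge set \<open>E\<close> and two maps \<open>s\<close>, \<open>t\<close> that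
  list the ends of each edge in an arbitrary order, and an orientation is the set \<open>F \<subseteq> E\<close> of edges
  that run from \<open>t\<close> to \<open>s\<close>. Orientations of \<open>G\<close>, \<open>G - e\<close> and \<open>G / e\<close> are then
  subsets of \<open>E\<close> or of \<open>E - {e}\<close>, and both recursions are splittings of a family of subsets
  according to whether they contain \<open>e\<close>.
\<close>

section \<open>Identifying two vertices of a relation\<close>

definition merge :: "'v \<Rightarrow> 'v \<Rightarrow> 'v \<Rightarrow> 'v" where
  "merge u v = id(u := v)"

definition contract_rel :: "'v \<Rightarrow> 'v \<Rightarrow> 'v rel \<Rightarrow> 'v rel" where
  "contract_rel u v R = map_prod (merge u v) (merge u v) ` R"

lemma merge_eq_iff:
  "merge u v x = merge u v y \<longleftrightarrow> x = y \<or> (x \<in> {u, v} \<and> y \<in> {u, v})"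
  by (auto simp: merge_def)

lemma contract_relI: "(x, y) \<in> R \<Longrightarrow> (merge u v x, merge u v y) \<in> contract_rel u v R"
  unfolding contract_rel_def by (metis image_eqI map_prod_simp)

lemma contract_relE:
  assumes "(a, b) \<in> contract_rel u v R"
  obtains x y where "(x, y) \<in> R" "a = merge u v x" "b = merge u v y"
  using assms unfolding contract_rel_def by auto

lemma trancl_contract_rel:
  "(x, y) \<in> R\<^sup>+ \<Longrightarrow> (merge u v x, merge u v y) \<in> (contract_rel u v R)\<^sup>+"
proof (induction rule: trancl_induct)
  case (base y)
  then show ?case by (blast intro: contract_relI)
next
  case (step y z)
  then show ?case by (meson contract_relI trancl.trancl_into_trancl)
qed

text \<open>
  A path in the quotient lifts to a path in \<open>R\<close>, except that it may jump between \<open>u\<close> and \<open>v\<close>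
  when it visits the merged vertex. If \<open>R\<close> has no nonempty path from
  \<open>{u, v}\<close> to \<open>{u, v}\<close>, this happens at most once.
\<close>

lemma trancl_contract_relD:
  assumes "(x, y) \<in> (contract_rel u v R)\<^sup>+"
    and no_path: "\<And>a b. a \<in> {u, v} \<Longrightarrow> b \<in> {u, v} \<Longrightarrow> (a, b) \<notin> R\<^sup>+"
  shows "\<exists>a b. merge u v a = x \<and> merge u v b = y \<and>
    ((a, b) \<in> R\<^sup>+ \<or> (\<exists>c\<in>{u, v}. \<exists>c'\<in>{u, v}. (a, c) \<in> R\<^sup>+ \<and> (c', b) \<in> R\<^sup>+))"
  using assms(1)
proof (induction rule: trancl_induct)
  case (base y)
  then show ?case by (blast elim: contract_relE)
next
  case (step y z)
  from step.IH obtain a b where ab: "merge u v a = x" "merge u v b = y" and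
    path: "(a, b) \<in> R\<^sup>+ \<or> (\<exists>c\<in>{u, v}. \<exists>c'\<in>{u, v}. (a, c) \<in> R\<^sup>+ \<and> (c', b) \<in> R\<^sup>+)"
    by blast
  from step.hyps(2) obtain b' d where d: "(b', d) \<in> R" "y = merge u v b'" "z = merge u v d"
    by (rule contract_relE)
  from ab(2) d(2) consider "b = b'" | "b \<in> {u, v}" "b' \<in> {u, v}"
    by (metis merge_eq_iff)
  then show ?case
  proof cases
    case 1
    then have "(a, d) \<in> R\<^sup>+ \<or> (\<exists>c\<in>{u, v}. \<exists>c'\<in>{u, v}. (a, c) \<in> R\<^sup>+ \<and> (c', d) \<in> R\<^sup>+)"
      using path d(1) by (meson trancl.trancl_into_trancl)
    then show ?thesis using ab(1) d(3) by blast
  next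
    case 2
    then have "(a, b) \<in> R\<^sup>+" using path no_path by blast
    moreover have "(b', d) \<in> R\<^sup>+" using d(1) by blast
    ultimately show ?thesis using ab(1) d(3) 2 by blast
  qed
qed

lemma acyclic_contract_rel_iff:
  assumes "u \<noteq> v"
  shows "acyclic (contract_rel u v R) \<longleftrightarrow> acyclic R \<and> (u, v) \<notin> R\<^sup>* \<and> (v, u) \<notin> R\<^sup>*"
proof
  assume L: "acyclic (contract_rel u v R)"
  have no: "(x, y) \<notin> R\<^sup>+" if "merge u v x = merge u v y" for x y
    using L trancl_contract_rel[of x y R u v] that by (auto simp: acyclic_def)
  then have "(u, v) \<notin> R\<^sup>+" "(v, u) \<notin> R\<^sup>+" by (auto simp: merge_eq_iff)
  then show "acyclic R \<and> (u, v) \<notin> R\<^sup>* \<and> (v, u) \<notin> R\<^sup>*"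
    using no assms by (auto simp: acyclic_def rtrancl_eq_or_trancl)
next
  assume R: "acyclic R \<and> (u, v) \<notin> R\<^sup>* \<and> (v, u) \<notin> R\<^sup>*"
  have no_path: "(a, b) \<notin> R\<^sup>+" if "a \<in> {u, v}" "b \<in> {u, v}" for a b
    using that R by (auto simp: acyclic_def dest: trancl_into_rtrancl)
  show "acyclic (contract_rel u v R)"
  proof (rule acyclicI, safe)
    fix x assume "(x, x) \<in> (contract_rel u v R)\<^sup>+"
    then obtain a b where ab: "merge u v a = merge u v b" and
      path: "(a, b) \<in> R\<^sup>+ \<or> (\<exists>c\<in>{u, v}. \<exists>c'\<in>{u, v}. (a, c) \<in> R\<^sup>+ \<and> (c', b) \<in> R\<^sup>+)"
      using trancl_contract_relD[OF _ no_path] by metis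
    from ab consider "a = b" | "a \<in> {u, v}" "b \<in> {u, v}"
      by (metis merge_eq_iff)
    then show False
    proof cases
      case 1
      then show ?thesis using path R no_path by (meson acyclic_def trancl_trans)
    next
      case 2
      then show ?thesis using path no_path by blast
    qed
  qed
qed

section \<open>Acyclic orientations with a unique sink under deletion and contraction\<close>

text \<open>
  In an acyclic relation on \<open>V\<close> the sinks are exactly the vertices without outgoing arc.
\<close>

definition rooted_acyclic :: "'v set \<Rightarrow> 'v rel \<Rightarrow> 'v \<Rightarrow> bool" where
  "rooted_acyclic V R v0 \<longleftrightarrow> acyclic R \<and> {x \<in> V. x \<notin> Domain R} = {v0}"

lemma Domain_contract_rel: "Domain (contract_rel u v R) = merge u v ` Domain R"
  by (force simp: contract_rel_def)

text \<open>
  Only acyclic \<open>R\<close> contribute. Suppose \<open>v \<noteq> v0\<close>. If \<open>R\<close> has \<open>v0\<close> as its only sink,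
  neither extension changes the sinks, at least one is acyclic, and both are iff the contraction is. If \<open>R\<close> has one of \<open>u\<close>, \<open>v\<close> as an
  additional sink, only the arc leaving that vertex repairs this, and the new relation is acyclic iff
  the contraction is, because no path leaves the vertex in \<open>R\<close>. If both are
  additional sinks, one of them survives in each extension and the merged vertex is a sink of the
  contraction, so nothing is counted. If \<open>v = v0\<close>, only the arc from \<open>u\<close>
  to \<open>v\<close> is possible; it never closes a cycle, and \<open>u\<close> is a sink of \<open>R\<close> or not according to whether
  the contraction or the deletion is counted.
\<close>

lemma rooted_acyclic_deletion_contraction:
  assumes "u \<in> V" "v \<in> V" "u \<noteq> v" "u \<noteq> v0"
  shows "of_bool (rooted_acyclic V (insert (u, v) R) v0) + of_bool (rooted_acyclic V (insert (v, u) R) v0)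
    = of_bool (rooted_acyclic V R v0) +
      (of_bool (rooted_acyclic (V - {u}) (contract_rel u v R) v0) :: nat)"
proof -
  \<comment> \<open>the condition on the sinks away from \<open>u\<close> and \<open>v\<close>, common to all four relations\<close>
  define other where "other \<longleftrightarrow> (\<forall>x\<in>V - {u, v}. x \<notin> Domain R \<longleftrightarrow> x = v0)"
  have sinks: "{x \<in> V. x \<notin> Domain R} = {v0} \<longleftrightarrow>
      v0 \<in> V \<and> other \<and> u \<in> Domain R \<and> (v \<notin> Domain R \<longleftrightarrow> v = v0)"
    "{x \<in> V. x \<notin> Domain (insert (u, v) R)} = {v0} \<longleftrightarrow>
      v0 \<in> V \<and> other \<and> (v \<notin> Domain R \<longleftrightarrow> v = v0)"
    "{x \<in> V. x \<notin> Domain (insert (v, u) R)} = {v0} \<longleftrightarrow>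
      v0 \<in> V \<and> other \<and> u \<in> Domain R \<and> v \<noteq> v0"
    using assms unfolding other_def by blast+
  have merge: "x \<in> merge u v ` Domain R \<longleftrightarrow> (if x = v then u \<in> Domain R \<or> v \<in> Domain R else x \<in> Domain R)"
    if "x \<noteq> u" for x
    using that assms by (auto simp: merge_def image_iff)
  have sinks': "{x \<in> V - {u}. x \<notin> merge u v ` Domain R} = {v0} \<longleftrightarrow>
      v0 \<in> V \<and> other \<and> (u \<notin> Domain R \<and> v \<notin> Domain R \<longleftrightarrow> v = v0)"
  proof -
    have "{x \<in> V - {u}. x \<notin> merge u v ` Domain R} =
      {x \<in> V - {u, v}. x \<notin> Domain R} \<union> (if u \<notin> Domain R \<and> v \<notin> Domain R then {v} else {})"
    proof (rule set_eqI)
      fix x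
      show "x \<in> {x \<in> V - {u}. x \<notin> merge u v ` Domain R} \<longleftrightarrow>
        x \<in> {x \<in> V - {u, v}. x \<notin> Domain R} \<union> (if u \<notin> Domain R \<and> v \<notin> Domain R then {v} else {})"
        using assms(2,3) merge[of x] by (cases "x = u"; cases "x = v"; simp del: image_iff)
    qed
    then show ?thesis using assms unfolding other_def by auto
  qed
  have path: "(u, v) \<in> R\<^sup>* \<Longrightarrow> u \<in> Domain R" "(v, u) \<in> R\<^sup>* \<Longrightarrow> v \<in> Domain R"
    using assms(3) by (metis DomainI converse_rtranclE)+
  have anti: "acyclic R \<Longrightarrow> (u, v) \<in> R\<^sup>* \<Longrightarrow> (v, u) \<notin> R\<^sup>*"
    using assms(3) by (meson acyclic_impl_antisym_rtrancl antisymD)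
  show ?thesis
    unfolding rooted_acyclic_def Domain_contract_rel sinks sinks' acyclic_insert
      acyclic_contract_rel_iff[OF assms(3)]
    using path anti by (cases "v = v0"; cases "u \<in> Domain R"; cases "v \<in> Domain R"; auto)
qed

definition oriented_arcs :: "'e set \<Rightarrow> ('e \<Rightarrow> 'v) \<Rightarrow> ('e \<Rightarrow> 'v) \<Rightarrow> 'e set \<Rightarrow> 'v rel" where
  "oriented_arcs E s t F = (\<lambda>e. if e \<in> F then (t e, s e) else (s e, t e)) ` E"

lemma oriented_arcs_contract:
  "oriented_arcs E (merge u v \<circ> s) (merge u v \<circ> t) F = contract_rel u v (oriented_arcs E s t F)"
  unfolding oriented_arcs_def contract_rel_def image_image by (rule image_cong) auto

lemma oriented_arcs_insert:
  assumes "e \<notin> E" "F \<subseteq> E"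
  shows "oriented_arcs (insert e E) s t F = insert (s e, t e) (oriented_arcs E s t F)"
    and "oriented_arcs (insert e E) s t (insert e F) = insert (t e, s e) (oriented_arcs E s t F)"
proof -
  show "oriented_arcs (insert e E) s t F = insert (s e, t e) (oriented_arcs E s t F)"
    using assms by (auto simp: oriented_arcs_def)
  have "(\<lambda>x. if x \<in> insert e F then (t x, s x) else (s x, t x)) ` E
      = (\<lambda>x. if x \<in> F then (t x, s x) else (s x, t x)) ` E"
    using assms by (intro image_cong) auto
  then show "oriented_arcs (insert e E) s t (insert e F) = insert (t e, s e) (oriented_arcs E s t F)"
    by (simp add: oriented_arcs_def)
qed

lemma not_acyclic_loop:
  assumes "e \<in> E" "s e = t e"
  shows "\<not> acyclic (oriented_arcs E s t F)"
proof -
  have "(s e, s e) \<in> oriented_arcs E s t F"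
    using assms unfolding oriented_arcs_def image_iff by (intro bexI[of _ e]) auto
  then show ?thesis by (auto simp: acyclic_def)
qed

lemma card_subsets_insert:
  assumes "finite E" "e \<notin> E"
  shows "card {F. F \<subseteq> insert e E \<and> P F} =
    card {F. F \<subseteq> E \<and> P F} + card {F. F \<subseteq> E \<and> P (insert e F)}"
proof -
  have eq: "{F. F \<subseteq> insert e E \<and> P F} =
    {F. F \<subseteq> E \<and> P F} \<union> insert e ` {F. F \<subseteq> E \<and> P (insert e F)}" (is "_ = ?A \<union> insert e ` ?B")
  proof (intro equalityI subsetI)
    fix F assume F: "F \<in> {F. F \<subseteq> insert e E \<and> P F}"
    show "F \<in> ?A \<union> insert e ` ?B"
    proof (cases "e \<in> F")
      case True
      then have "F = insert e (F - {e})" "F - {e} \<subseteq> E" using F by auto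
      then show ?thesis using F by (metis (mono_tags, lifting) UnI2 image_eqI mem_Collect_eq)
    next
      case False
      then show ?thesis using F by auto
    qed
  qed auto
  have fin: "finite ?A" "finite ?B" using assms(1) by auto
  have "inj_on (insert e) ?B" using assms(2) by (auto simp: inj_on_def)
  moreover have "?A \<inter> insert e ` ?B = {}" using assms(2) by auto
  ultimately show ?thesis
    unfolding eq using fin by (simp add: card_Un_disjoint card_image)
qed

lemma card_subsets_eq_sum:
  assumes "finite E"
  shows "card {F. F \<subseteq> E \<and> P F} = (\<Sum>F\<in>Pow E. of_bool (P F))"
proof -
  have "{F. F \<subseteq> E \<and> P F} = {F \<in> Pow E. P F}" by auto
  then show ?thesis using assms by (simp add: sum.If_cases of_bool_def Int_def)
qed

lemma card_rooted_acyclic_deletion_contraction: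
  assumes "finite E" "e \<notin> E" "{s e, t e} = {u, v}" "u \<in> V" "v \<in> V" "u \<noteq> v" "u \<noteq> v0"
  shows "card {F. F \<subseteq> insert e E \<and> rooted_acyclic V (oriented_arcs (insert e E) s t F) v0} =
    card {F. F \<subseteq> E \<and> rooted_acyclic V (oriented_arcs E s t F) v0} +
    card {F. F \<subseteq> E \<and> rooted_acyclic (V - {u})
      (oriented_arcs E (merge u v \<circ> s) (merge u v \<circ> t) F) v0}"
proof -
  have ends: "s e = u \<and> t e = v \<or> s e = v \<and> t e = u"
    using assms(3) by (auto simp: doubleton_eq_iff)
  show ?thesis
    unfolding card_subsets_insert[OF assms(1,2)] card_subsets_eq_sum[OF assms(1)] sum.distrib[symmetric]
    using ends
    by (intro sum.cong refl)
      (auto simp: oriented_arcs_insert[OF assms(2)] oriented_arcs_contract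
        rooted_acyclic_deletion_contraction[OF assms(4-7), symmetric])
qed

section \<open>Sets without broken circuits under deletion and contraction\<close>

definition links :: "('e \<Rightarrow> 'v) \<Rightarrow> ('e \<Rightarrow> 'v) \<Rightarrow> 'e set \<Rightarrow> 'v rel" where
  "links s t T = (\<lambda>f. (s f, t f)) ` T \<union> (\<lambda>f. (t f, s f)) ` T"

definition below :: "'e rel \<Rightarrow> 'e set \<Rightarrow> 'e \<Rightarrow> 'e set" where
  "below r S e = {f \<in> S. (f, e) \<in> r \<and> f \<noteq> e}"

text \<open>
  This is the absence of broken circuits from \<open>S\<close> (see \<open>broken_circuit_complex_iff\<close>): a path of
  smaller edges of \<open>S\<close> between the ends of \<open>e\<close> closes up with \<open>e\<close> to a circuit whose largest edge is
  \<open>e\<close>. A loop has its ends joined by the empty path, in accordance with its broken circuit being empty.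
\<close>

definition no_broken_circuit :: "'e rel \<Rightarrow> 'e set \<Rightarrow> ('e \<Rightarrow> 'v) \<Rightarrow> ('e \<Rightarrow> 'v) \<Rightarrow> 'e set \<Rightarrow> bool" where
  "no_broken_circuit r E s t S \<longleftrightarrow> (\<forall>e\<in>E. (s e, t e) \<notin> (links s t (below r S e))\<^sup>*)"

lemma links_contract: "links (merge u v \<circ> s) (merge u v \<circ> t) T = contract_rel u v (links s t T)"
  unfolding links_def contract_rel_def by (simp add: image_Un image_image)

lemma sym_links: "sym ((links s t T)\<^sup>*)"
  by (intro sym_rtrancl) (auto simp: links_def sym_def)

lemma links_mono: "T \<subseteq> T' \<Longrightarrow> links s t T \<subseteq> links s t T'"
  by (auto simp: links_def)

text \<open>
  Vertices identified by the contraction are joined by \<open>e\<close> itself, so each step of a path in the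
  contraction lifts to a path that may use \<open>e\<close>; conversely \<open>e\<close> becomes an empty path.
\<close>

lemma connected_contract_iff:
  assumes "{s e, t e} = {u, v}"
  shows "(merge u v x, merge u v y) \<in> (links (merge u v \<circ> s) (merge u v \<circ> t) T)\<^sup>* \<longleftrightarrow>
    (x, y) \<in> (links s t (insert e T))\<^sup>*" (is "?L \<longleftrightarrow> ?R")
proof
  let ?K = "(links s t (insert e T))\<^sup>*"
  have fibre: "(x, y) \<in> ?K" if "merge u v x = merge u v y" for x y
  proof -
    have "(s e, t e) \<in> ?K" "(t e, s e) \<in> ?K" by (auto simp: links_def)
    then show ?thesis using that assms by (auto simp: merge_eq_iff doubleton_eq_iff)
  qed
  have "\<forall>x. merge u v x = x' \<longrightarrow> (x, y) \<in> ?K"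
    if "(x', y') \<in> (contract_rel u v (links s t T))\<^sup>*" "merge u v y = y'" for x' y' y
    using that
  proof (induction rule: converse_rtrancl_induct)
    case base
    then show ?case by (simp add: fibre)
  next
    case (step x' z')
    from step.hyps(1) obtain a b where ab: "(a, b) \<in> links s t T" "x' = merge u v a" "z' = merge u v b"
      by (rule contract_relE)
    have "(a, b) \<in> ?K" using ab(1) links_mono[of T "insert e T" s t] by blast
    moreover have "(b, y) \<in> ?K" using step ab(3) by blast
    ultimately have "(a, y) \<in> ?K" by (rule rtrancl_trans)
    then show ?case using ab(2) fibre rtrancl_trans by metis
  qed
  then show "?L \<Longrightarrow> ?R" unfolding links_contract by blast
next
  let ?c = "contract_rel u v (links s t T)"
  assume ?R
  then show ?L unfolding links_contract
  proof (induction rule: rtrancl_induct)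
    case (step y z)
    have "merge u v y = merge u v z \<or> (y, z) \<in> links s t T"
      using step.hyps(2) assms by (auto simp: links_def merge_eq_iff doubleton_eq_iff)
    then have "(merge u v y, merge u v z) \<in> ?c\<^sup>*" by (auto intro: contract_relI)
    with step.IH show ?case by (rule rtrancl_trans)
  qed auto
qed

text \<open>
  No edge is smaller than \<open>e\<close>, so the condition at \<open>e\<close> only says that \<open>e\<close> is not a loop.
\<close>

lemma no_broken_circuit_deletion:
  assumes "S \<subseteq> E" "antisym r" "\<And>f. f \<in> E \<Longrightarrow> (e, f) \<in> r" "s e \<noteq> t e"
  shows "no_broken_circuit r (insert e E) s t S \<longleftrightarrow> no_broken_circuit r E s t S"
proof -
  have "below r S e = {}" using assms(1-3) by (auto simp: below_def dest: antisymD)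
  then show ?thesis using assms(4) by (simp add: no_broken_circuit_def links_def)
qed

text \<open>
  Here minimality of \<open>e\<close> is used a second time: \<open>e\<close> is available for every connection
  that the condition at another edge forbids.
\<close>

lemma no_broken_circuit_contraction:
  assumes "S \<subseteq> E" "e \<notin> E" "antisym r" "\<And>f. f \<in> E \<Longrightarrow> (e, f) \<in> r"
    and "{s e, t e} = {u, v}" "u \<noteq> v"
  shows "no_broken_circuit r (insert e E) s t (insert e S) \<longleftrightarrow>
    no_broken_circuit r E (merge u v \<circ> s) (merge u v \<circ> t) S"
proof -
  have "below r (insert e S) e = {}" using assms(1,3,4) by (auto simp: below_def dest: antisymD)
  moreover have "s e \<noteq> t e" using assms(5,6) by (auto simp: doubleton_eq_iff)
  moreover have "below r (insert e S) f = insert e (below r S f)" if "f \<in> E" for f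
    using that assms(2,4) by (auto simp: below_def)
  ultimately show ?thesis
    using connected_contract_iff[where s = s and t = t, OF assms(5)]
    by (simp add: no_broken_circuit_def links_def[of _ _ "{}"])
qed

section \<open>The common recursion\<close>

lemma linear_order_on_has_least:
  assumes "finite E" "E \<noteq> {}" "linear_order_on A r" "E \<subseteq> A"
  shows "\<exists>e\<in>E. \<forall>f\<in>E. (e, f) \<in> r"
  using assms(1,2,4)
proof (induction rule: finite_ne_induct)
  case (singleton x)
  then show ?case using assms(3) by (auto simp: linear_order_on_def partial_order_on_def
    preorder_on_def refl_on_def)
next
  case (insert x F)
  then obtain e where e: "e \<in> F" "\<forall>f\<in>F. (e, f) \<in> r" by auto
  have lin: "trans r" "total_on A r" "refl_on A r" using assms(3)
    by (auto simp: linear_order_on_def partial_order_on_def preorder_on_def)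
  have refl: "(x, x) \<in> r" using lin(3) insert.prems by (simp add: refl_onD)
  have "x \<in> A" "e \<in> A" "x \<noteq> e" using e(1) insert.prems insert.hyps by auto
  then consider "(x, e) \<in> r" | "(e, x) \<in> r"
    using lin(2) unfolding total_on_def by blast
  then show ?case
  proof cases
    case 1
    then have "(x, f) \<in> r" if "f \<in> F" for f using that e(2) lin(1) by (blast dest: transD)
    then show ?thesis using refl by blast
  next
    case 2
    then show ?thesis using e by blast
  qed
qed

text \<open>
  The vertex set and the end maps vary in the induction, whereas the ambient set \<open>A\<close> of the order
  stays fixed, so that the order never has to be restricted to the remaining edges.
\<close>

theorem card_rooted_acyclic_eq_card_no_broken_circuit:
  assumes "finite V" "finite E" "s ` E \<subseteq> V" "t ` E \<subseteq> V" "v0 \<in> V" "linear_order_on A r" "E \<subseteq> A"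
  shows "card {F. F \<subseteq> E \<and> rooted_acyclic V (oriented_arcs E s t F) v0} =
    card {S. S \<subseteq> E \<and> no_broken_circuit r E s t S \<and> Suc (card S) = card V}"
  using assms(1-5,7)
proof (induction "card E" arbitrary: V E s t)
  case 0
  then have E: "E = {}" by simp
  have "V = {v0} \<longleftrightarrow> Suc 0 = card V"
    using \<open>v0 \<in> V\<close> by (auto simp: card_1_singleton_iff dest!: sym[of "Suc 0"])
  then have "rooted_acyclic V {} v0 \<longleftrightarrow> Suc (card ({} :: 'b set)) = card V"
    by (simp add: rooted_acyclic_def acyclic_def)
  moreover have "{S. S \<subseteq> {} \<and> P S} = (if P {} then {{}} else {})" for P :: "'b set \<Rightarrow> bool" by auto
  ultimately show ?case
    unfolding E by (simp add: oriented_arcs_def no_broken_circuit_def)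
next
  case (Suc n)
  then have "E \<noteq> {}" by auto
  with Suc.prems obtain e where e: "e \<in> E" "\<forall>f\<in>E. (e, f) \<in> r"
    using linear_order_on_has_least[OF _ _ assms(6)] by blast
  have anti: "antisym r" using assms(6) by (auto simp: linear_order_on_def partial_order_on_def)
  show ?case
  proof (cases "s e = t e")
    case True
    have "\<not> no_broken_circuit r E s t S" for S 
      unfolding no_broken_circuit_def using e(1) True by (metis rtrancl.rtrancl_refl)
    moreover have "\<not> rooted_acyclic V (oriented_arcs E s t F) v0" for F
      using not_acyclic_loop[where s = s and t = t, OF e(1) True] by (auto simp: rooted_acyclic_def)
    ultimately show ?thesis by simp
  next
    case False
    define E' where "E' = E - {e}"
    have E: "E = insert e E'" "e \<notin> E'" using e(1) by (auto simp: E'_def)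
    have fin: "finite E'" using Suc.prems E by simp
    have n: "n = card E'" using Suc.hyps(2) E fin by simp
    have least: "f \<in> E' \<Longrightarrow> (e, f) \<in> r" for f using e(2) E by auto
    obtain u v where uv: "{s e, t e} = {u, v}" "u \<noteq> v" "u \<noteq> v0"
      using False by (metis insert_commute)
    then have "u \<in> {s e, t e}" "v \<in> {s e, t e}" by auto
    then have V: "u \<in> V" "v \<in> V" using Suc.prems(3,4) e(1) by auto
    have cV: "card V = Suc (card (V - {u}))" using V Suc.prems(1) by (metis card_Suc_Diff1)
    have del: "card {F. F \<subseteq> E' \<and> rooted_acyclic V (oriented_arcs E' s t F) v0} =
      card {S. S \<subseteq> E' \<and> no_broken_circuit r E' s t S \<and> Suc (card S) = card V}"
      using Suc.prems E n by (intro Suc.hyps(1)) auto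
    have contr: "card {F. F \<subseteq> E' \<and> rooted_acyclic (V - {u})
        (oriented_arcs E' (merge u v \<circ> s) (merge u v \<circ> t) F) v0} =
      card {S. S \<subseteq> E' \<and> no_broken_circuit r E' (merge u v \<circ> s) (merge u v \<circ> t) S \<and>
        Suc (card S) = card (V - {u})}"
      using Suc.prems E n uv V by (intro Suc.hyps(1)) (auto simp: merge_def)
    have "card {S. S \<subseteq> E \<and> no_broken_circuit r E s t S \<and> Suc (card S) = card V} =
      card {S. S \<subseteq> E' \<and> no_broken_circuit r E s t S \<and> Suc (card S) = card V} +
      card {S. S \<subseteq> E' \<and> no_broken_circuit r E s t (insert e S) \<and> Suc (card (insert e S)) = card V}"
      unfolding E(1) by (rule card_subsets_insert[OF fin E(2)])
    also have "{S. S \<subseteq> E' \<and> no_broken_circuit r E s t S \<and> Suc (card S) = card V} =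
      {S. S \<subseteq> E' \<and> no_broken_circuit r E' s t S \<and> Suc (card S) = card V}"
      unfolding E(1) using no_broken_circuit_deletion[where s = s and t = t, OF _ anti least] False by blast
    also have "{S. S \<subseteq> E' \<and> no_broken_circuit r E s t (insert e S) \<and> Suc (card (insert e S)) = card V} =
      {S. S \<subseteq> E' \<and> no_broken_circuit r E' (merge u v \<circ> s) (merge u v \<circ> t) S \<and>
        Suc (card S) = card (V - {u})}"
    proof -
      have "card (insert e S) = Suc (card S)" if "S \<subseteq> E'" for S
        using that E(2) fin by (meson card_insert_disjoint finite_subset subsetD)
      then show ?thesis
        unfolding E(1)
        using no_broken_circuit_contraction[where s = s and t = t, OF _ E(2) anti least uv(1,2)] cV
        by auto
    qed
    finally show ?thesis
      using card_rooted_acyclic_deletion_contraction[where s = s and t = t, OF fin E(2) uv(1) V uv(2,3)] del contr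
      unfolding E(1) by simp
  qed
qed

section \<open>Orientations as sets of reversed edges\<close>

lemma acyclic_digraph_iff:
  assumes "wf_digraph D"
  shows "acyclic_digraph D \<longleftrightarrow> acyclic (arcs_ends D)"
proof -
  interpret wf_digraph D by fact
  show ?thesis
  proof
    assume "acyclic_digraph D"
    then show "acyclic (arcs_ends D)"
      unfolding acyclic_digraph_def acyclic_def
      using closed_w_imp_cycle by (metis closed_w_def length_greater_0_conv reachable1_awalk)
  next
    assume "acyclic (arcs_ends D)"
    then show "acyclic_digraph D"
      unfolding acyclic_digraph_def acyclic_def cycle_def by (metis reachable1_awalk)
  qed
qed

lemma unique_sink_at_iff:
  assumes "acyclic (arcs_ends D)"
  shows "unique_sink_at D v \<longleftrightarrow> {x \<in> verts D. x \<notin> Domain (arcs_ends D)} = {v}"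
proof -
  have noloop: "a \<in> arcs D \<Longrightarrow> tail D a \<noteq> head D a" for a
    using assms by (auto simp: acyclic_def arcs_ends_def arc_to_ends_def)
  have "sink D x \<longleftrightarrow> x \<in> verts D \<and> x \<notin> Domain (arcs_ends D)" for x
    using noloop by (force simp: sink_def arcs_ends_def arc_to_ends_def)
  then show ?thesis unfolding unique_sink_at_def by blast
qed

definition reorient :: "('v, 'e) multigraph \<Rightarrow> ('e \<Rightarrow> 'v) \<Rightarrow> ('e \<Rightarrow> 'v) \<Rightarrow> 'e set \<Rightarrow> ('v, 'e) pre_digraph" where
  "reorient G s t F = \<lparr>verts = vertices G, arcs = edges G,
     tail = (\<lambda>e\<in>edges G. if e \<in> F then t e else s e),
     head = (\<lambda>e\<in>edges G. if e \<in> F then s e else t e)\<rparr>"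

lemma arcs_ends_reorient: "arcs_ends (reorient G s t F) = oriented_arcs (edges G) s t F"
  unfolding arcs_ends_def oriented_arcs_def reorient_def arc_to_ends_def by (auto intro!: image_cong)

text \<open>
  Reversing a loop does not change an orientation, so \<open>reorient\<close> is injective only in the absence of
  loops; this is guaranteed here because a loop rules out any acyclic orientation.
\<close>

lemma bij_betw_reorient:
  assumes ends: "\<And>e. e \<in> edges G \<Longrightarrow> s e \<in> vertices G \<and> t e \<in> vertices G \<and> ends G e = {s e, t e}"
  shows "bij_betw (reorient G s t)
    {F. F \<subseteq> edges G \<and> rooted_acyclic (vertices G) (oriented_arcs (edges G) s t F) v0}
    {D \<in> orientations G. acyclic_digraph D \<and> unique_sink_at D v0}"
    (is "bij_betw _ ?A ?B")
proof -
  have wf: "wf_digraph (reorient G s t F)" for F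
    using ends by unfold_locales (auto simp: reorient_def)
  have orient: "reorient G s t F \<in> orientations G" for F
    using ends by (auto simp: reorient_def orientations_def)
  have iff: "acyclic_digraph (reorient G s t F) \<and> unique_sink_at (reorient G s t F) v0 \<longleftrightarrow>
      rooted_acyclic (vertices G) (oriented_arcs (edges G) s t F) v0" for F
    using unique_sink_at_iff[of "reorient G s t F" v0]
    unfolding acyclic_digraph_iff[OF wf] rooted_acyclic_def arcs_ends_reorient
    by (auto simp: reorient_def)
  have "inj_on (reorient G s t) ?A"
  proof (rule inj_onI)
    fix F F' assume F: "F \<in> ?A" "F' \<in> ?A" "reorient G s t F = reorient G s t F'"
    have noloop: "s e \<noteq> t e" if "e \<in> edges G" for e
      using not_acyclic_loop[where s = s and t = t, OF that] F(1) by (auto simp: rooted_acyclic_def)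
    have "tail (reorient G s t F) e = tail (reorient G s t F') e" for e using F(3) by simp
    then have "e \<in> F \<longleftrightarrow> e \<in> F'" if "e \<in> edges G" for e
      using noloop[OF that] that by (auto simp: reorient_def split: if_splits) metis+
    then show "F = F'" using F(1,2) by blast
  qed
  moreover have "reorient G s t ` ?A = ?B"
  proof (intro equalityI subsetI)
    fix D assume "D \<in> reorient G s t ` ?A"
    then show "D \<in> ?B" using orient iff by auto
  next
    fix D assume D: "D \<in> ?B"
    define F where "F = {e \<in> edges G. tail D e \<noteq> s e}"
    have "D = reorient G s t F"
    proof (rule pre_digraph.equality)
      have e: "tail D e = s e \<and> head D e = t e \<or> tail D e = t e \<and> head D e = s e"
        if "e \<in> edges G" for e
        using D ends[OF that] that by (auto simp: orientations_def doubleton_eq_iff)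
      have ext: "tail D \<in> extensional (edges G)" "head D \<in> extensional (edges G)"
        using D by (auto simp: orientations_def)
      show "tail D = tail (reorient G s t F)"
        by (rule extensionalityI[OF ext(1)])
          (use e in \<open>auto simp: reorient_def F_def\<close>)
      have "head D e = (if e \<in> F then s e else t e)" if "e \<in> edges G" for e
        using e[OF that] that by (auto simp: F_def)
      then show "head D = head (reorient G s t F)"
        by (intro extensionalityI[OF ext(2)]) (auto simp: reorient_def)
    qed (use D in \<open>auto simp: reorient_def orientations_def\<close>)
    moreover from this have "rooted_acyclic (vertices G) (oriented_arcs (edges G) s t F) v0"
      using D iff[of F] by simp
    moreover have "F \<subseteq> edges G" by (auto simp: F_def)
    ultimately show "D \<in> reorient G s t ` ?A" by blast
  qed
  ultimately show ?thesis by (simp add: bij_betw_def)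
qed

section \<open>Broken circuits and connectivity\<close>

lemma connected_imp_distinct_path:
  assumes "(x, y) \<in> (links s t T)\<^sup>*"
  shows "\<exists>vs es. length vs = Suc (length es) \<and> distinct vs \<and> set es \<subseteq> T \<and> vs ! 0 = x \<and>
    vs ! length es = y \<and> (\<forall>i<length es. {s (es ! i), t (es ! i)} = {vs ! i, vs ! Suc i})"
  using assms
proof (induction rule: converse_rtrancl_induct)
  case base
  show ?case by (intro exI[of _ "[y]"] exI[of _ "[]"]) auto
next
  case (step x z)
  then obtain vs es where p: "length vs = Suc (length es)" "distinct vs" "set es \<subseteq> T"
    "vs ! 0 = z" "vs ! length es = y"
    "\<forall>i<length es. {s (es ! i), t (es ! i)} = {vs ! i, vs ! Suc i}" by blast
  show ?case
  proof (cases "x \<in> set vs")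
    case True
    then obtain k where k: "k \<le> length es" "vs ! k = x" using p(1) by (auto simp: in_set_conv_nth less_Suc_eq_le)
    then show ?thesis using p
      by (intro exI[of _ "drop k vs"] exI[of _ "drop k es"]) (auto dest: in_set_dropD)
  next
    case False
    obtain f where "f \<in> T" "{s f, t f} = {x, z}" using step.hyps(1) by (auto simp: links_def)
    then show ?thesis using p False
      by (intro exI[of _ "x # vs"] exI[of _ "f # es"]) (auto simp: nth_Cons split: nat.split)
  qed
qed

text \<open>
  Removing \<open>e\<close> from a circuit leaves a path between the ends of \<open>e\<close>; conversely a path without
  repeated vertices repeats no edge either, so \<open>e\<close> closes it to a circuit. This covers a loop
  (empty path) and a pair of parallel edges (path of length one).
\<close>

lemma circuit_through_edge_iff:
  assumes ends: "\<And>e. e \<in> edges G \<Longrightarrow> s e \<in> vertices G \<and> t e \<in> vertices G \<and> ends G e = {s e, t e}"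
    and T: "T \<subseteq> edges G" and e: "e \<in> edges G" "e \<notin> T"
  shows "(\<exists>C. circuit G C \<and> e \<in> C \<and> C - {e} \<subseteq> T) \<longleftrightarrow> (s e, t e) \<in> (links s t T)\<^sup>*"
proof
  assume "\<exists>C. circuit G C \<and> e \<in> C \<and> C - {e} \<subseteq> T"
  then obtain vs es where c: "length vs = length es" "distinct es" "set es \<subseteq> edges G"
    "\<forall>i < length es. ends G (es ! i) = {vs ! i, vs ! ((i + 1) mod length es)}"
    "e \<in> set es" "set es - {e} \<subseteq> T"
    unfolding circuit_def by blast
  define n where "n = length es"
  obtain j where j: "j < n" "es ! j = e" using c(5) by (auto simp: in_set_conv_nth n_def)
  \<comment> \<open>go around the circuit, starting behind \<open>e\<close>; \<open>k < n\<close> ensures that \<open>e\<close> is not traversed\<close>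
  have walk: "(vs ! ((j + 1) mod n), vs ! ((j + 1 + k) mod n)) \<in> (links s t T)\<^sup>*" if "k < n" for k
    using that
  proof (induction k)
    case (Suc k)
    let ?i = "(j + 1 + k) mod n"
    have "?i < n" using j by simp
    have "?i = (if j + 1 + k < n then j + 1 + k else j + 1 + k - n)"
      using Suc.prems j by (simp add: mod_if)
    then have "?i \<noteq> j" using Suc.prems j by (auto split: if_splits)
    then have "es ! ?i \<in> T"
      using c(2,6) j \<open>?i < n\<close> by (metis DiffI n_def nth_eq_iff_index_eq nth_mem singletonD subsetD)
    moreover have "{s (es ! ?i), t (es ! ?i)} = {vs ! ?i, vs ! ((?i + 1) mod n)}"
      using c(3,4) ends \<open>?i < n\<close> unfolding n_def by (metis nth_mem subsetD)
    ultimately have "(vs ! ?i, vs ! ((?i + 1) mod n)) \<in> links s t T"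
      by (force simp: links_def doubleton_eq_iff)
    moreover have "(?i + 1) mod n = (j + 1 + Suc k) mod n" by (simp add: mod_simps)
    ultimately show ?case using Suc by (metis Suc_lessD rtrancl.rtrancl_into_rtrancl)
  qed simp
  have "(j + 1 + (n - 1)) mod n = j" using j by simp
  then have conn: "(vs ! ((j + 1) mod n), vs ! j) \<in> (links s t T)\<^sup>*" using walk[of "n - 1"] j by simp
  have "{s e, t e} = {vs ! j, vs ! ((j + 1) mod n)}" using c(4) j ends e(1) unfolding n_def by metis
  then show "(s e, t e) \<in> (links s t T)\<^sup>*"
    using conn sym_links[of s t T] by (auto simp: doubleton_eq_iff dest: symD)
next
  assume "(s e, t e) \<in> (links s t T)\<^sup>*"
  from connected_imp_distinct_path[OF this] obtain vs es where p:
    "length vs = Suc (length es)" "distinct vs" "set es \<subseteq> T"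
    "vs ! 0 = s e" "vs ! length es = t e"
    "\<forall>i<length es. {s (es ! i), t (es ! i)} = {vs ! i, vs ! Suc i}"
    by (elim exE conjE)
  have "distinct es" unfolding distinct_conv_nth
  proof (intro allI impI notI)
    fix i k assume ik: "i < length es" "k < length es" "i \<noteq> k" "es ! i = es ! k"
    then have "{vs ! i, vs ! Suc i} = {vs ! k, vs ! Suc k}" using p(6) by metis
    then show False using ik p(1,2) by (auto simp: doubleton_eq_iff nth_eq_iff_index_eq)
  qed
  moreover have "set vs \<subseteq> vertices G"
  proof
    fix x assume "x \<in> set vs"
    then obtain i where i: "i \<le> length es" "x = vs ! i" using p(1) by (auto simp: in_set_conv_nth less_Suc_eq_le)
    show "x \<in> vertices G"
    proof (cases "i = length es")
      case True
      then show ?thesis using i p(5) ends e(1) by simp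
    next
      case False
      then have "i < length es" using i(1) by simp
      then have "es ! i \<in> edges G" using p(3) T by (metis nth_mem subsetD)
      moreover have "x \<in> {s (es ! i), t (es ! i)}" using i(2) p(6) \<open>i < length es\<close> by auto
      ultimately show ?thesis using ends by blast
    qed
  qed
  moreover have "\<forall>i < length (es @ [e]). ends G ((es @ [e]) ! i) = {vs ! i, vs ! ((i + 1) mod length (es @ [e]))}"
  proof (intro allI impI)
    fix i assume "i < length (es @ [e])"
    then consider "i < length es" | "i = length es" by fastforce
    then show "ends G ((es @ [e]) ! i) = {vs ! i, vs ! ((i + 1) mod length (es @ [e]))}"
    proof cases
      case 1
      then have "es ! i \<in> edges G" using p(3) T by (metis nth_mem subsetD)
      then show ?thesis using 1 p(6) ends by (simp add: nth_append)
    next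
      case 2
      then show ?thesis using p(4,5) ends e(1) by (auto simp: nth_append)
    qed
  qed
  ultimately have "circuit G (set (es @ [e]))"
    unfolding circuit_def using p(1-3) e T
    by (intro exI[of _ vs] exI[of _ "es @ [e]"]) auto
  then show "\<exists>C. circuit G C \<and> e \<in> C \<and> C - {e} \<subseteq> T" using p(3) by (intro exI[of _ "set (es @ [e])"]) auto
qed

lemma circuit_subset_edges: "circuit G C \<Longrightarrow> C \<subseteq> edges G"
  by (auto simp: circuit_def)

lemma broken_circuit_complex_iff:
  assumes ends: "\<And>e. e \<in> edges G \<Longrightarrow> s e \<in> vertices G \<and> t e \<in> vertices G \<and> ends G e = {s e, t e}"
    and "refl_on (edges G) r"
  shows "S \<in> broken_circuit_complex G r \<longleftrightarrow> S \<subseteq> edges G \<and> no_broken_circuit r (edges G) s t S"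
proof -
  have "(\<exists>B. broken_circuit G r B \<and> B \<subseteq> S) \<longleftrightarrow> (\<exists>e\<in>edges G. (s e, t e) \<in> (links s t (below r S e))\<^sup>*)"
    if S: "S \<subseteq> edges G"
  proof -
    have "(\<exists>B. broken_circuit G r B \<and> B \<subseteq> S) \<longleftrightarrow>
      (\<exists>e\<in>edges G. \<exists>C. circuit G C \<and> e \<in> C \<and> C - {e} \<subseteq> below r S e)"
    proof
      assume "\<exists>B. broken_circuit G r B \<and> B \<subseteq> S"
      then show "\<exists>e\<in>edges G. \<exists>C. circuit G C \<and> e \<in> C \<and> C - {e} \<subseteq> below r S e"
        unfolding broken_circuit_def below_def using circuit_subset_edges by blast
    next
      assume "\<exists>e\<in>edges G. \<exists>C. circuit G C \<and> e \<in> C \<and> C - {e} \<subseteq> below r S e"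
      then obtain e C where C: "e \<in> edges G" "circuit G C" "e \<in> C" "C - {e} \<subseteq> below r S e" by blast
      then have "\<forall>f\<in>C. (f, e) \<in> r" using assms(2) by (auto simp: below_def refl_on_def)
      then show "\<exists>B. broken_circuit G r B \<and> B \<subseteq> S"
        using C by (intro exI[of _ "C - {e}"]) (auto simp: broken_circuit_def below_def)
    qed
    also have "\<dots> \<longleftrightarrow> (\<exists>e\<in>edges G. (s e, t e) \<in> (links s t (below r S e))\<^sup>*)"
      using S by (intro bex_cong refl circuit_through_edge_iff ends) (auto simp: below_def)
    finally show ?thesis .
  qed
  then show ?thesis unfolding broken_circuit_complex_def no_broken_circuit_def by blast
qed

theorem theorem4p1:
  fixes G :: "('v, 'e) multigraph"
    and r :: "'e rel"
    and d :: nat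
    and v0 :: 'v
  assumes "finite_multigraph G"
    and "card (vertices G) = d"
    and "linear_order_on (edges G) r"
    and "v0 \<in> vertices G"
  shows "card {D \<in> orientations G. acyclic_digraph D \<and> unique_sink_at D v0} =
         card {S \<in> broken_circuit_complex G r. card S = d - 1}"
proof -
  have fin: "finite (vertices G)" "finite (edges G)"
    and "\<forall>e\<in>edges G. \<exists>u v. u \<in> vertices G \<and> v \<in> vertices G \<and> ends G e = {u, v}"
    using assms(1) unfolding finite_multigraph_def by blast+
  then obtain s t where ends:
    "\<And>e. e \<in> edges G \<Longrightarrow> s e \<in> vertices G \<and> t e \<in> vertices G \<and> ends G e = {s e, t e}"
    by metis
  have refl: "refl_on (edges G) r"
    using assms(3) by (auto simp: linear_order_on_def partial_order_on_def preorder_on_def)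
  have d: "Suc k = card (vertices G) \<longleftrightarrow> k = d - 1" for k
    using assms(2,4) fin(1) card_gt_0_iff[of "vertices G"] by auto
  have "card {D \<in> orientations G. acyclic_digraph D \<and> unique_sink_at D v0} =
    card {F. F \<subseteq> edges G \<and> rooted_acyclic (vertices G) (oriented_arcs (edges G) s t F) v0}"
    using bij_betw_same_card[OF bij_betw_reorient[OF ends]] by simp
  also have "\<dots> = card {S. S \<subseteq> edges G \<and> no_broken_circuit r (edges G) s t S \<and>
      Suc (card S) = card (vertices G)}"
    using ends
    by (intro card_rooted_acyclic_eq_card_no_broken_circuit[OF fin _ _ assms(4,3) order.refl]) auto
  also have "\<dots> = card {S \<in> broken_circuit_complex G r. card S = d - 1}"
    unfolding d by (simp add: broken_circuit_complex_iff[OF ends refl] conj_assoc)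
  finally show ?thesis .
qed

end
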